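(* As $m\to\infty$, $$\mathrm{forb}(m,\{Q_3,F_{11}\})=\Theta(m^{3/2}).$$
   Context: A matrix is simple if it is a $(0,1)$-matrix with no repeated columns. $F\prec A$ means that some submatrix of $A$ is a row and column permutation of $F$. For a family $\mathcal F$ of $(0,1)$-matrices, $\mathrm{forb}(m,\mathcal F)$ is the maximum number of columns of an $m$-rowed simple matrix $A$ with $F\nprec A$ for all $F\in\mathcal F$. The configurations are $$Q_3=\begin{bmatrix}0&0&0&1&1&1\\0&1&1&0&0&1\end{bmatrix},\qquad F_{11}=\begin{bmatrix}1&0&1&0\\1&0&0&1\\0&1&1&0\\0&1&0&1\end{bmatrix}.$$ *)

theory Defs
  imports
    Jordan_Normal_Form.DL_Submatrix
    "HOL-Combinatorics.Permutations"
    "HOL-Library.Landau_Symbols"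
begin

definition zero_one_mat :: "int mat \<Rightarrow> bool" where
  "zero_one_mat A \<longleftrightarrow> elements_mat A \<subseteq> {0, 1}"

definition simple_mat :: "int mat \<Rightarrow> bool" where
  "simple_mat A \<longleftrightarrow> zero_one_mat A \<and> distinct (cols A)"

definition row_col_permutation_of :: "'a mat \<Rightarrow> 'a mat \<Rightarrow> bool" where
  "row_col_permutation_of B F \<longleftrightarrow>
     (\<exists>p q. p permutes {..<dim_row F} \<and> q permutes {..<dim_col F} \<and>
        B = mat (dim_row F) (dim_col F) (\<lambda>(i, j). F $$ (p i, q j)))"

definition configuration_in :: "'a mat \<Rightarrow> 'a mat \<Rightarrow> bool" (infix "\<prec>" 50) where
  "F \<prec> A \<longleftrightarrow> (\<exists>I J. row_col_permutation_of (submatrix A I J) F)"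

definition avoiding_mats :: "nat \<Rightarrow> int mat set \<Rightarrow> int mat set" where
  "avoiding_mats m \<F> = {A. dim_row A = m \<and> simple_mat A \<and> (\<forall>F\<in>\<F>. \<not> F \<prec> A)}"

definition forb :: "nat \<Rightarrow> int mat set \<Rightarrow> nat" where
  "forb m \<F> = Max (dim_col ` avoiding_mats m \<F>)"

text \<open>The maximum is attained: the column counts are bounded by the number of
  (0,1)-vectors of length m, and the matrix without columns avoids every family
  whose members all have a column.\<close>

lemma finite_dim_col_avoiding_mats: "finite (dim_col ` avoiding_mats m \<F>)"
proof -
  define V :: "int vec set" where "V = vec_of_list ` {xs. set xs \<subseteq> {0, 1} \<and> length xs = m}"
  have fin: "finite V"
    unfolding V_def by (intro finite_imageI finite_lists_length_eq) simp
  have "dim_col A \<le> card V" if A: "A \<in> avoiding_mats m \<F>" for A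
  proof -
    have A': "dim_row A = m" "elements_mat A \<subseteq> {0, 1}" "distinct (cols A)"
      using A unfolding avoiding_mats_def simple_mat_def zero_one_mat_def by blast+
    have "col A j \<in> V" if j: "j < dim_col A" for j
    proof -
      let ?xs = "list_of_vec (col A j)"
      have "A $$ (i, j) \<in> {0, 1}" if "i < dim_row A" for i
        using A'(2) elements_matI[OF carrier_matI[OF refl refl] that j refl] by (rule subsetD)
      then have "set ?xs \<subseteq> {0, 1}"
        unfolding set_list_of_vec vec_set_def using j by (auto simp del: insert_iff)
      moreover have "length ?xs = m"
        using A'(1) by simp
      ultimately show ?thesis
        unfolding V_def by (metis (mono_tags, lifting) image_eqI mem_Collect_eq vec_list)
    qed
    then have "set (cols A) \<subseteq> V"
      unfolding cols_def by auto
    then have "card (set (cols A)) \<le> card V"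
      by (rule card_mono[OF fin])
    then show ?thesis
      unfolding distinct_card[OF A'(3)] by simp
  qed
  then have "dim_col ` avoiding_mats m \<F> \<subseteq> {..card V}"
    by blast
  then show ?thesis
    by (rule finite_subset) simp
qed

lemma avoiding_mats_nonempty:
  assumes "\<forall>F\<in>\<F>. dim_col F > 0"
  shows "avoiding_mats m \<F> \<noteq> {}"
proof -
  have "\<not> F \<prec> mat m 0 f" if "F \<in> \<F>" for F f
  proof
    assume "F \<prec> mat m 0 f"
    then obtain I J p q where
      "submatrix (mat m 0 f) I J = mat (dim_row F) (dim_col F) (\<lambda>(i, j). F $$ (p i, q j))"
      unfolding configuration_in_def row_col_permutation_of_def by blast
    then have "dim_col (submatrix (mat m 0 f) I J) = dim_col F"
      by simp
    then show False using assms that by (auto simp: dim_submatrix)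
  qed
  then have "mat m 0 (\<lambda>_. 0) \<in> avoiding_mats m \<F>"
    by (auto simp: avoiding_mats_def simple_mat_def zero_one_mat_def cols_def elements_mat_def)
  then show ?thesis by blast
qed

definition Q3 :: "int mat" where
  "Q3 = mat_of_rows_list 6
     [[0, 0, 0, 1, 1, 1],
      [0, 1, 1, 0, 0, 1]]"

definition F11 :: "int mat" where
  "F11 = mat_of_rows_list 4
     [[1, 0, 1, 0],
      [1, 0, 0, 1],
      [0, 1, 1, 0],
      [0, 1, 0, 1]]"

end

theory Submission
  imports Defs "HOL-Algebra.Algebraic_Closure_Type" "HOL-Library.Z2"
begin

no_notation var ("X\<index>")

text \<open>Columns are regarded as sets of rows. Every product of two of the identity matrix \<open>I\<close>, its
  complement and the triangular matrix contains \<open>Q3\<close>, except the product of \<open>I\<close> with its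
  complement, whose columns are the edges of a complete bipartite graph; there \<open>F11\<close> is a 4-cycle.
  Hence the incidence graphs of affine planes give the lower bound. Planes over fields with \<open>2\<^sup>n\<close>
  elements suffice, so no result on the distribution of primes is needed.

  For the upper bound, delete a row \<open>r\<close>: the number of columns drops by the number of columns \<open>X\<close>
  for which both values in row \<open>r\<close> occur. By \<open>Q3\<close>-freeness every other row has at most one 1 or at
  most one 0 on these \<open>X\<close>, so up to complementing all columns, half of them are told apart by a
  private row \<open>i\<close> in which only \<open>X\<close> has a 1, and then \<open>X\<close> is the only column at all with a 1 in row
  \<open>i\<close> and a 0 in row \<open>r\<close>. The sets of private rows of two rows \<open>r\<close> share at most one element, as
  two common elements give \<open>F11\<close>. So on \<open>m\<close> rows, the drop is \<open>O(\<surd>m)\<close> for a suitable \<open>r\<close>.\<close>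

section \<open>Upper bound for set families\<close>

text \<open>In rows \<open>a\<close> and \<open>b\<close>, \<open>Q3\<close> has the columns 00 and
  11 once and the columns 10 and 01 twice. Only the repeated columns need inequalities; membership
  separates the other columns and the two rows.\<close>

definition Q3_free :: "'a set set \<Rightarrow> bool" where
  "Q3_free \<A> \<longleftrightarrow> \<not> (\<exists>a b. \<exists>W\<in>\<A>. \<exists>X\<in>\<A>. \<exists>Y\<in>\<A>. \<exists>Y'\<in>\<A>. \<exists>Z\<in>\<A>. \<exists>Z'\<in>\<A>.
     a \<notin> W \<and> b \<notin> W \<and> a \<in> X \<and> b \<in> X \<and> Y \<noteq> Y' \<and> Z \<noteq> Z' \<and>
     a \<in> Y \<and> b \<notin> Y \<and> a \<in> Y' \<and> b \<notin> Y' \<and> a \<notin> Z \<and> b \<in> Z \<and> a \<notin> Z' \<and> b \<in> Z')"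

text \<open>With columns read as pairs of rows, \<open>F11\<close> is the 4-cycle with edges ab, cd,
  ac, bd. The membership pattern forces all four rows and all four columns to be distinct.\<close>

definition F11_free :: "'a set set \<Rightarrow> bool" where
  "F11_free \<A> \<longleftrightarrow> \<not> (\<exists>a b c d. \<exists>W\<in>\<A>. \<exists>X\<in>\<A>. \<exists>Y\<in>\<A>. \<exists>Z\<in>\<A>.
     a \<in> W \<and> b \<in> W \<and> c \<notin> W \<and> d \<notin> W \<and>
     a \<notin> X \<and> b \<notin> X \<and> c \<in> X \<and> d \<in> X \<and>
     a \<in> Y \<and> b \<notin> Y \<and> c \<in> Y \<and> d \<notin> Y \<and>
     a \<notin> Z \<and> b \<in> Z \<and> c \<notin> Z \<and> d \<in> Z)"

lemma Q3_freeD: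
  assumes "Q3_free \<A>" "W \<in> \<A>" "X \<in> \<A>" "Y \<in> \<A>" "Y' \<in> \<A>" "Z \<in> \<A>" "Z' \<in> \<A>"
    and "a \<notin> W" "b \<notin> W" "a \<in> X" "b \<in> X" "Y \<noteq> Y'" "Z \<noteq> Z'"
    and "a \<in> Y" "b \<notin> Y" "a \<in> Y'" "b \<notin> Y'" "a \<notin> Z" "b \<in> Z" "a \<notin> Z'" "b \<in> Z'"
  shows False
  using assms(1) unfolding Q3_free_def
  by (rule notE)
    (intro exI[of _ a] exI[of _ b] bexI[of _ W] bexI[of _ X] bexI[of _ Y] bexI[of _ Y']
      bexI[of _ Z] bexI[of _ Z'] conjI assms)

lemma Q3_freeI:
  assumes "\<And>a b W X Y Y' Z Z'. W \<in> \<A> \<Longrightarrow> X \<in> \<A> \<Longrightarrow> Y \<in> \<A> \<Longrightarrow> Y' \<in> \<A> \<Longrightarrow> Z \<in> \<A> \<Longrightarrow> Z' \<in> \<A> \<Longrightarrow>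
    a \<notin> W \<Longrightarrow> b \<notin> W \<Longrightarrow> a \<in> X \<Longrightarrow> b \<in> X \<Longrightarrow> Y \<noteq> Y' \<Longrightarrow> Z \<noteq> Z' \<Longrightarrow>
    a \<in> Y \<Longrightarrow> b \<notin> Y \<Longrightarrow> a \<in> Y' \<Longrightarrow> b \<notin> Y' \<Longrightarrow> a \<notin> Z \<Longrightarrow> b \<in> Z \<Longrightarrow> a \<notin> Z' \<Longrightarrow> b \<in> Z' \<Longrightarrow> False"
  shows "Q3_free \<A>"
  unfolding Q3_free_def by (intro notI, elim exE bexE conjE) (rule assms)

lemma F11_freeD:
  assumes "F11_free \<A>" "W \<in> \<A>" "X \<in> \<A>" "Y \<in> \<A>" "Z \<in> \<A>"
    and "a \<in> W" "b \<in> W" "c \<notin> W" "d \<notin> W" "a \<notin> X" "b \<notin> X" "c \<in> X" "d \<in> X"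
    and "a \<in> Y" "b \<notin> Y" "c \<in> Y" "d \<notin> Y" "a \<notin> Z" "b \<in> Z" "c \<notin> Z" "d \<in> Z"
  shows False
  using assms(1) unfolding F11_free_def
  by (rule notE)
    (intro exI[of _ a] exI[of _ b] exI[of _ c] exI[of _ d] bexI[of _ W] bexI[of _ X]
      bexI[of _ Y] bexI[of _ Z] conjI assms)

lemma F11_freeI:
  assumes "\<And>a b c d W X Y Z. W \<in> \<A> \<Longrightarrow> X \<in> \<A> \<Longrightarrow> Y \<in> \<A> \<Longrightarrow> Z \<in> \<A> \<Longrightarrow>
    a \<in> W \<Longrightarrow> b \<in> W \<Longrightarrow> c \<notin> W \<Longrightarrow> d \<notin> W \<Longrightarrow> a \<notin> X \<Longrightarrow> b \<notin> X \<Longrightarrow> c \<in> X \<Longrightarrow> d \<in> X \<Longrightarrow>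
    a \<in> Y \<Longrightarrow> b \<notin> Y \<Longrightarrow> c \<in> Y \<Longrightarrow> d \<notin> Y \<Longrightarrow> a \<notin> Z \<Longrightarrow> b \<in> Z \<Longrightarrow> c \<notin> Z \<Longrightarrow> d \<in> Z \<Longrightarrow> False"
  shows "F11_free \<A>"
  unfolding F11_free_def by (intro notI, elim exE bexE conjE) (rule assms)

text \<open>Complementation swaps 00 with 11 and 10 with 01, so up to column order \<open>Q3\<close>
  is its own complement. This lets a private 0 be treated as a private 1.\<close>

lemma Q3_free_uminus:
  assumes "Q3_free \<A>"
  shows "Q3_free (uminus ` \<A>)"
proof (rule Q3_freeI, elim imageE)
  fix a b W X Y Y' Z Z' W0 X0 Y0 Y0' Z0 Z0'
  assume "W0 \<in> \<A>" "X0 \<in> \<A>" "Y0 \<in> \<A>" "Y0' \<in> \<A>" "Z0 \<in> \<A>" "Z0' \<in> \<A>"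
    and "W = - W0" "X = - X0" "Y = - Y0" "Y' = - Y0'" "Z = - Z0" "Z' = - Z0'"
    and "a \<notin> W" "b \<notin> W" "a \<in> X" "b \<in> X" "Y \<noteq> Y'" "Z \<noteq> Z'"
    and "a \<in> Y" "b \<notin> Y" "a \<in> Y'" "b \<notin> Y'" "a \<notin> Z" "b \<in> Z" "a \<notin> Z'" "b \<in> Z'"
  then show False
    by (intro Q3_freeD[OF assms, of X0 W0 Z0 Z0' Y0 Y0' a b]) simp_all
qed

lemma F11_free_uminus:
  assumes "F11_free \<A>"
  shows "F11_free (uminus ` \<A>)"
proof (rule F11_freeI, elim imageE)
  fix a b c d W X Y Z W0 X0 Y0 Z0
  assume "W0 \<in> \<A>" "X0 \<in> \<A>" "Y0 \<in> \<A>" "Z0 \<in> \<A>"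
    and "W = - W0" "X = - X0" "Y = - Y0" "Z = - Z0"
    and "a \<in> W" "b \<in> W" "c \<notin> W" "d \<notin> W" "a \<notin> X" "b \<notin> X" "c \<in> X" "d \<in> X"
    and "a \<in> Y" "b \<notin> Y" "c \<in> Y" "d \<notin> Y" "a \<notin> Z" "b \<in> Z" "c \<notin> Z" "d \<in> Z"
  then show False
    by (intro F11_freeD[OF assms, of X0 W0 Z0 Y0 a b c d]) simp_all
qed

section \<open>Deleting a row\<close>

definition double_sets :: "'a set set \<Rightarrow> 'a \<Rightarrow> 'a set set" where
  "double_sets \<A> r = {X\<in>\<A>. r \<notin> X \<and> insert r X \<in> \<A>}"

text \<open>After the deletion, the columns that had a 0 in row \<open>r\<close> and those that had
  a 1 overlap exactly in \<open>double_sets \<A> r\<close>.\<close>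

lemma card_eq_deletion_plus_double:
  assumes "finite \<A>"
  shows "card \<A> = card ((\<lambda>X. X - {r}) ` \<A>) + card (double_sets \<A> r)"
proof -
  let ?D = "\<lambda>X. X - {r}"
  define P where "P = {X\<in>\<A>. r \<notin> X}"
  define Q where "Q = {X\<in>\<A>. r \<in> X}"
  have fin: "finite P" "finite Q" and PQ: "\<A> = P \<union> Q" "P \<inter> Q = {}"
    using assms by (auto simp: P_def Q_def)
  have "?D ` P = P"
    unfolding P_def by force
  then have D: "?D ` \<A> = P \<union> ?D ` Q"
    by (simp add: PQ image_Un)
  have "P \<inter> ?D ` Q = double_sets \<A> r"
  proof (intro equalityI subsetI)
    fix X assume "X \<in> double_sets \<A> r"
    then have "insert r X \<in> Q" "X \<in> P" "X = ?D (insert r X)"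
      by (auto simp: double_sets_def P_def Q_def)
    then show "X \<in> P \<inter> ?D ` Q"
      by blast
  qed (auto simp: double_sets_def P_def Q_def insert_absorb)
  moreover have "card (?D ` Q) = card Q"
    by (rule card_image, rule inj_onI) (unfold Q_def, blast)
  moreover have "card \<A> = card P + card Q"
    unfolding PQ(1) using fin PQ(2) by (rule card_Un_disjoint)
  moreover have "card P + card (?D ` Q) = card (P \<union> ?D ` Q) + card (P \<inter> ?D ` Q)"
    using fin by (intro card_Un_Int) auto
  ultimately show ?thesis
    by (simp add: D)
qed

text \<open>Each row of the configuration has a 1 in some column, while row \<open>r\<close> has
  none left. So the rows differ from \<open>r\<close>, and the configuration lifts to the original
  columns.\<close>

lemma Q3_free_deletion:
  assumes "Q3_free \<A>"
  shows "Q3_free ((\<lambda>X. X - {r}) ` \<A>)"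
proof (rule Q3_freeI, elim imageE)
  fix a b W X Y Y' Z Z' W0 X0 Y0 Y0' Z0 Z0'
  assume *: "W0 \<in> \<A>" "X0 \<in> \<A>" "Y0 \<in> \<A>" "Y0' \<in> \<A>" "Z0 \<in> \<A>" "Z0' \<in> \<A>"
    and eqs: "W = W0 - {r}" "X = X0 - {r}" "Y = Y0 - {r}" "Y' = Y0' - {r}" "Z = Z0 - {r}" "Z' = Z0' - {r}"
    and **: "a \<notin> W" "b \<notin> W" "a \<in> X" "b \<in> X" "Y \<noteq> Y'" "Z \<noteq> Z'"
      "a \<in> Y" "b \<notin> Y" "a \<in> Y'" "b \<notin> Y'" "a \<notin> Z" "b \<in> Z" "a \<notin> Z'" "b \<in> Z'"
  have "a \<noteq> r" "b \<noteq> r" "Y0 \<noteq> Y0'" "Z0 \<noteq> Z0'"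
    using ** eqs by auto
  with * ** eqs show False
    by (intro Q3_freeD[OF assms, of W0 X0 Y0 Y0' Z0 Z0' a b]) simp_all
qed

lemma F11_free_deletion:
  assumes "F11_free \<A>"
  shows "F11_free ((\<lambda>X. X - {r}) ` \<A>)"
proof (rule F11_freeI, elim imageE)
  fix a b c d W X Y Z W0 X0 Y0 Z0
  assume *: "W0 \<in> \<A>" "X0 \<in> \<A>" "Y0 \<in> \<A>" "Z0 \<in> \<A>"
    and eqs: "W = W0 - {r}" "X = X0 - {r}" "Y = Y0 - {r}" "Z = Z0 - {r}"
    and **: "a \<in> W" "b \<in> W" "c \<notin> W" "d \<notin> W" "a \<notin> X" "b \<notin> X" "c \<in> X" "d \<in> X"
      "a \<in> Y" "b \<notin> Y" "c \<in> Y" "d \<notin> Y" "a \<notin> Z" "b \<in> Z" "c \<notin> Z" "d \<in> Z"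
  have "a \<noteq> r" "b \<noteq> r" "c \<noteq> r" "d \<noteq> r"
    using ** eqs by auto
  with * ** eqs show False
    by (intro F11_freeD[OF assms, of W0 X0 Y0 Z0 a b c d]) simp_all
qed

text \<open>Each \<open>i \<in> S\<close> is joined to \<open>r\<close> by the only column with entry 1 in row \<open>i\<close> and 0 in
  row \<open>r\<close>. The configuration \<open>F11\<close> is a 4-cycle of this graph.\<close>

definition spread :: "'a set set \<Rightarrow> 'a \<Rightarrow> 'a set \<Rightarrow> bool" where
  "spread \<A> r S \<longleftrightarrow>
     (\<forall>i\<in>S. \<exists>X. {Y\<in>\<A>. i \<in> Y \<and> r \<notin> Y} = {X} \<and> insert r X \<in> \<A> \<and> X \<inter> S = {i})"

lemma spreadE:
  assumes "spread \<A> r S" "i \<in> S"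
  obtains X where "{Y\<in>\<A>. i \<in> Y \<and> r \<notin> Y} = {X}" "insert r X \<in> \<A>" "X \<inter> S = {i}"
  using assms unfolding spread_def by metis

lemma spread_mono:
  assumes "spread \<A> r S" "T \<subseteq> S"
  shows "spread \<A> r T"
  unfolding spread_def
proof
  fix i assume "i \<in> T"
  then have "i \<in> S"
    using assms(2) by blast
  with assms(1) obtain X where X: "{Y\<in>\<A>. i \<in> Y \<and> r \<notin> Y} = {X}" "insert r X \<in> \<A>" "X \<inter> S = {i}"
    by (rule spreadE)
  have "X \<inter> T = {i}"
    using X(3) \<open>i \<in> T\<close> assms(2) by blast
  with X(1,2) show "\<exists>X. {Y\<in>\<A>. i \<in> Y \<and> r \<notin> Y} = {X} \<and> insert r X \<in> \<A> \<and> X \<inter> T = {i}"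
    by (intro exI[of _ X] conjI)
qed

text \<open>If \<open>r'\<close> were missing from the column \<open>X\<close> that joins
  \<open>i\<close> to \<open>r\<close>, then \<open>X\<close> and \<open>insert r X\<close> would
  both have a 1 in row \<open>i\<close> and a 0 in row \<open>r'\<close>, against uniqueness for
  \<open>r'\<close>.\<close>

lemma spread_column:
  assumes S: "spread \<A> r S" "i \<in> S" "j \<in> S" "i \<noteq> j"
    and S': "spread \<A> r' S'" "i \<in> S'" "r \<noteq> r'"
  shows "\<exists>X\<in>\<A>. i \<in> X \<and> j \<notin> X \<and> r \<notin> X \<and> r' \<in> X"
proof -
  obtain X where X: "{Y\<in>\<A>. i \<in> Y \<and> r \<notin> Y} = {X}" "insert r X \<in> \<A>" "X \<inter> S = {i}"
    using S(1,2) by (rule spreadE)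
  obtain X' where X': "{Y\<in>\<A>. i \<in> Y \<and> r' \<notin> Y} = {X'}"
    using S'(1,2) by (rule spreadE)
  have mem: "X \<in> \<A>" "i \<in> X" "r \<notin> X"
    using equalityD2[OF X(1)] by simp_all
  have "r' \<in> X"
  proof (rule ccontr)
    assume "r' \<notin> X"
    then have "X \<in> {Y\<in>\<A>. i \<in> Y \<and> r' \<notin> Y}" "insert r X \<in> {Y\<in>\<A>. i \<in> Y \<and> r' \<notin> Y}"
      using mem X(2) S'(3) by simp_all
    with \<open>r \<notin> X\<close> show False
      unfolding X' by blast
  qed
  moreover have "j \<notin> X"
    using X(3) S(3,4) by (metis IntI singletonD)
  ultimately show ?thesis
    using mem by blast
qed

text \<open>Two common elements \<open>i\<close>, \<open>j\<close>, each joined to both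
  \<open>r\<close> and \<open>r'\<close>, form a 4-cycle: the four columns from
  \<open>spread_column\<close> give \<open>F11\<close> in the rows \<open>i\<close>,
  \<open>r'\<close>, \<open>r\<close>, \<open>j\<close>.\<close>

lemma spread_inter:
  assumes "F11_free \<A>" "r \<noteq> r'" "spread \<A> r S" "spread \<A> r' S'"
    and "i \<in> S \<inter> S'" "j \<in> S \<inter> S'"
  shows "i = j"
proof (rule ccontr)
  assume "i \<noteq> j"
  obtain W where "W\<in>\<A>" "i \<in> W \<and> j \<notin> W \<and> r \<notin> W \<and> r' \<in> W"
    using spread_column[of \<A> r S i j r' S'] assms \<open>i \<noteq> j\<close> by auto
  moreover obtain X where "X\<in>\<A>" "i \<notin> X \<and> j \<in> X \<and> r \<in> X \<and> r' \<notin> X"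
    using spread_column[of \<A> r' S' j i r S] assms \<open>i \<noteq> j\<close> by auto
  moreover obtain Y where "Y\<in>\<A>" "i \<in> Y \<and> j \<notin> Y \<and> r \<in> Y \<and> r' \<notin> Y"
    using spread_column[of \<A> r' S' i j r S] assms \<open>i \<noteq> j\<close> by auto
  moreover obtain Z where "Z\<in>\<A>" "i \<notin> Z \<and> j \<in> Z \<and> r \<notin> Z \<and> r' \<in> Z"
    using spread_column[of \<A> r S j i r' S'] assms \<open>i \<noteq> j\<close> by auto
  ultimately show False
    by (intro F11_freeD[OF assms(1), of W X Y Z i r' r j]) simp_all
qed

text \<open>Adding the sets one by one, each new set shares at most one element with each earlier
  one, so k sets cover at least ks - k(k-1)/2 elements. The bound is doubled and rearranged to stay
  within the natural numbers.\<close>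

lemma card_Union_almost_disjoint:
  assumes "finite R" "\<And>r. r \<in> R \<Longrightarrow> finite (S r) \<and> card (S r) = s"
    and "\<And>r r'. r \<in> R \<Longrightarrow> r' \<in> R \<Longrightarrow> r \<noteq> r' \<Longrightarrow> card (S r \<inter> S r') \<le> 1"
  shows "2 * card R * s \<le> 2 * card (\<Union>r\<in>R. S r) + card R * (card R - 1)"
  using assms
proof (induction R rule: finite_induct)
  case (insert x R)
  let ?U = "\<Union>r\<in>R. S r"
  define u v w k where "u = card ?U" "v = card (S x \<union> ?U)" "w = card (S x \<inter> ?U)" "k = card R"
  have "s + u = v + w"
    using insert.prems(1) insert.hyps(1) unfolding u_v_w_k_def
    by (subst card_Un_Int[symmetric]) auto
  moreover have "w \<le> k"
  proof -
    have "w = card (\<Union>r\<in>R. S x \<inter> S r)"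
      by (simp add: u_v_w_k_def)
    also have "\<dots> \<le> (\<Sum>r\<in>R. card (S x \<inter> S r))"
      by (rule card_UN_le) fact
    also have "\<dots> \<le> (\<Sum>r\<in>R. 1)"
      using insert.prems(2) insert.hyps(2) by (intro sum_mono) auto
    finally show ?thesis by (simp add: u_v_w_k_def)
  qed
  moreover have "2 * k * s \<le> 2 * u + k * (k - 1)"
    using insert unfolding u_v_w_k_def by blast
  moreover have "Suc k * (Suc k - 1) = k * (k - 1) + 2 * k"
    by (cases k) auto
  ultimately have "2 * Suc k * s \<le> 2 * v + Suc k * (Suc k - 1)"
    by simp
  then show ?case
    using insert.hyps by (simp add: u_v_w_k_def)
qed simp

text \<open>For exactly \<open>s\<close> of the rows, almost disjointness gives 2s^2 \<le> 2 card V
  + s(s-1), and s(s-1) \<le> s^2.\<close>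

lemma spread_bound:
  assumes "F11_free \<A>" "finite V" "finite R" "s \<le> card R"
    and "\<And>r. r \<in> R \<Longrightarrow> \<exists>S\<subseteq>V. card S = s \<and> spread \<A> r S"
  shows "s\<^sup>2 \<le> 2 * card V"
proof -
  obtain T where T: "T \<subseteq> R" "card T = s"
    using assms(4) by (rule obtain_subset_with_card_n)
  have "finite T"
    using T(1) assms(3) finite_subset by blast
  have "\<forall>r\<in>T. \<exists>S. S \<subseteq> V \<and> card S = s \<and> spread \<A> r S"
    using assms(5) T(1) by blast
  then obtain S where S: "\<And>r. r \<in> T \<Longrightarrow> S r \<subseteq> V \<and> card (S r) = s \<and> spread \<A> r (S r)"
    unfolding bchoice_iff by blast
  have "2 * card T * s \<le> 2 * card (\<Union>r\<in>T. S r) + card T * (card T - 1)"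
  proof (rule card_Union_almost_disjoint)
    fix r r' assume "r \<in> T" "r' \<in> T" "r \<noteq> r'"
    then have "i = j" if "i \<in> S r \<inter> S r'" "j \<in> S r \<inter> S r'" for i j
      using spread_inter[OF assms(1), of r r' "S r" "S r'"] S that by blast
    moreover have "finite (S r \<inter> S r')"
      using S[OF \<open>r \<in> T\<close>] assms(2) by (meson finite_Int finite_subset)
    ultimately show "card (S r \<inter> S r') \<le> 1"
      by (simp add: card_le_Suc0_iff_eq)
  next
    show "finite (S r) \<and> card (S r) = s" if "r \<in> T" for r
      using S[OF that] assms(2) finite_subset by blast
  qed fact
  moreover have "card (\<Union>r\<in>T. S r) \<le> card V"
    using S assms(2) by (intro card_mono) auto
  moreover have "s * (s - 1) \<le> s * s"
    by simp
  ultimately show ?thesis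
    unfolding T(2) power2_eq_square by linarith
qed

text \<open>The rows are private only within \<open>C\<close>; \<open>Q3\<close>-freeness makes them
  private among all columns with a 0 in row \<open>r\<close>. Completing \<open>Q3\<close> takes two
  columns of \<open>C\<close> besides \<open>X\<close>, hence the bound 3.\<close>

lemma spread_exists:
  assumes "Q3_free \<A>" and C: "C \<subseteq> double_sets \<A> r" "card C \<ge> 3"
    and T: "T \<subseteq> C" "\<And>X. X \<in> T \<Longrightarrow> \<exists>i\<in>X \<inter> V. \<forall>Y\<in>C. i \<in> Y \<longrightarrow> Y = X"
  shows "\<exists>S\<subseteq>V. card S = card T \<and> spread \<A> r S"
proof -
  have "\<forall>X\<in>T. \<exists>i. i \<in> X \<inter> V \<and> (\<forall>Y\<in>C. i \<in> Y \<longrightarrow> Y = X)"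
    using T(2) by blast
  then obtain f where f: "\<And>X. X \<in> T \<Longrightarrow> f X \<in> X \<inter> V"
    "\<And>X Y. X \<in> T \<Longrightarrow> Y \<in> C \<Longrightarrow> f X \<in> Y \<Longrightarrow> Y = X"
    unfolding bchoice_iff by blast
  have "inj_on f T"
  proof (rule inj_onI)
    fix X Y assume "X \<in> T" "Y \<in> T" "f X = f Y"
    then show "X = Y"
      using f(1)[of X] f(2)[of Y X] T(1) by auto
  qed
  moreover have "spread \<A> r (f ` T)"
    unfolding spread_def
  proof (intro ballI, elim imageE)
    fix i X assume i: "i = f X" and "X \<in> T"
    then have X: "X \<in> \<A>" "insert r X \<in> \<A>" "r \<notin> X" "i \<in> X" "X \<in> C"
      using C(1) T(1) f(1)[of X] by (auto simp: double_sets_def)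
    have "card (C - {X}) \<ge> 2"
      using C(2) X by (simp add: card_Diff_singleton)
    then obtain P where "P \<subseteq> C - {X}" "card P = 2"
      by (rule obtain_subset_with_card_n)
    then obtain Y Z where YZ: "Y \<in> C - {X}" "Z \<in> C - {X}" "Y \<noteq> Z"
      by (auto simp: card_2_iff)
    then have "i \<notin> Y" "i \<notin> Z"
      using f(2)[OF \<open>X \<in> T\<close>] i by blast+
    have YZ': "Y \<in> \<A>" "insert r Y \<in> \<A>" "r \<notin> Y" "insert r Z \<in> \<A>" "r \<notin> Z" "insert r Y \<noteq> insert r Z"
      using YZ C(1) by (auto simp: double_sets_def)
    have "i \<noteq> r" using X by blast
    \<comment> \<open>A second such column \<open>U\<close> would complete \<open>Q3\<close> in rows
      \<open>i\<close> and \<open>r\<close>: 00 is \<open>Y\<close>, 11 is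
      \<open>insert r X\<close>, 10 are \<open>U\<close> and \<open>X\<close>, 01 are
      \<open>insert r Y\<close> and \<open>insert r Z\<close>.\<close>
    have "U = X" if "U \<in> \<A>" "i \<in> U \<and> r \<notin> U" for U
    proof (rule ccontr)
      assume "U \<noteq> X"
      with that show False
        using X YZ' \<open>i \<notin> Y\<close> \<open>i \<notin> Z\<close> \<open>i \<noteq> r\<close>
        by (intro Q3_freeD[OF assms(1), of Y "insert r X" U X "insert r Y" "insert r Z" i r]) simp_all
    qed
    then have "{Y\<in>\<A>. i \<in> Y \<and> r \<notin> Y} = {X}"
      using X by blast
    moreover have "X \<inter> f ` T = {i}"
    proof (intro equalityI subsetI)
      fix j assume "j \<in> X \<inter> f ` T"
      then obtain Y where "Y \<in> T" "j = f Y" "f Y \<in> X"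
        by blast
      with f(2)[of Y X] X(5) i show "j \<in> {i}"
        by simp
    qed (use X i \<open>X \<in> T\<close> in simp)
    ultimately show "\<exists>X. {Y\<in>\<A>. i \<in> Y \<and> r \<notin> Y} = {X} \<and> insert r X \<in> \<A> \<and> X \<inter> f ` T = {i}"
      using X(2) by (intro exI[of _ X] conjI)
  qed
  moreover have "f ` T \<subseteq> V"
    using f(1) by blast
  ultimately show ?thesis
    by (intro exI[of _ "f ` T"]) (simp add: card_image)
qed

text \<open>A column in \<open>P\<close> has the only 1 in some row, a column in \<open>N\<close>
  the only 0. All but at most one of the 2s + 1 double columns lie in \<open>P\<close> or
  \<open>N\<close>, so one class has at least \<open>s\<close> members; complementing turns the case
  of \<open>N\<close> into that of \<open>P\<close>.\<close>

lemma spread_dichotomy: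
  assumes Q3: "Q3_free \<A>" and V: "\<A> \<subseteq> Pow V" "finite V"
    and card: "card (double_sets \<A> r) \<ge> 2 * s + 1" "s \<ge> 1"
  shows "\<exists>S\<subseteq>V. card S = s \<and> (spread \<A> r S \<or> spread (uminus ` \<A>) r S)"
proof -
  let ?C = "double_sets \<A> r"
  \<comment> \<open>The complement of \<open>X\<close>, except that row \<open>r\<close> keeps its
    0. It sends double sets of the family to double sets of the complemented family.\<close>
  let ?c = "\<lambda>X. - insert r X"
  define P where "P = {X\<in>?C. \<exists>i\<in>X \<inter> V. \<forall>Y\<in>?C. i \<in> Y \<longrightarrow> Y = X}"
  define N where "N = {X\<in>?C. \<exists>i\<in>V - insert r X. \<forall>Y\<in>?C. i \<notin> Y \<longrightarrow> Y = X}"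
  have fin: "finite ?C"
    using V by (auto simp: double_sets_def intro: finite_subset)
  have wlog: "X \<in> P \<or> Y \<in> N" if "X \<in> ?C" "Y \<in> ?C" "i \<in> X" "i \<notin> Y" for X Y i
  proof -
    have i: "i \<in> V" "i \<noteq> r"
      using that V by (auto simp: double_sets_def)
    \<comment> \<open>Otherwise rows \<open>i\<close> and \<open>r\<close> contain
      \<open>Q3\<close>: 10 in \<open>X\<close> and \<open>Z\<close>, 01 in
      \<open>insert r Y\<close> and \<open>insert r Z'\<close>, 00 in \<open>Y\<close>, 11 in
      \<open>insert r X\<close>.\<close>
    have "(\<forall>Z\<in>?C. i \<in> Z \<longrightarrow> Z = X) \<or> (\<forall>Z\<in>?C. i \<notin> Z \<longrightarrow> Z = Y)"
    proof (rule ccontr)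
      assume "\<not> ?thesis"
      then obtain Z Z' where Z: "Z \<in> ?C" "i \<in> Z" "Z \<noteq> X" "Z' \<in> ?C" "i \<notin> Z'" "Z' \<noteq> Y"
        by blast
      have "insert r Z' \<noteq> insert r Y"
        using Z that by (auto simp: double_sets_def)
      then show False
        using Z that i
        by (intro Q3_freeD[OF Q3, of Y "insert r X" X Z "insert r Y" "insert r Z'" i r])
          (simp_all add: double_sets_def)
    qed
    then show ?thesis
      using that i by (auto simp: P_def N_def)
  qed
  \<comment> \<open>Two distinct columns differ in some row, so by \<open>wlog\<close> they cannot
    both lie outside \<open>P\<close> and \<open>N\<close>.\<close>
  have "card (?C - (P \<union> N)) \<le> 1"
    using fin wlog by (intro iffD2[OF card_le_Suc0_iff_eq, folded One_nat_def]) blast+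
  moreover have "card ?C \<le> card (?C - (P \<union> N)) + card (P \<union> N)"
    using fin by (intro order_trans[OF card_mono card_Un_le]) (auto simp: P_def N_def)
  moreover have "card (P \<union> N) \<le> card P + card N"
    by (rule card_Un_le)
  ultimately consider "card P \<ge> s" | "card N \<ge> s"
    using card by linarith
  then have "\<exists>S\<subseteq>V. card S \<ge> s \<and> (spread \<A> r S \<or> spread (uminus ` \<A>) r S)"
  proof cases
    case 1
    have "\<exists>S\<subseteq>V. card S = card P \<and> spread \<A> r S"
      by (rule spread_exists[OF Q3, of ?C]) (use card in \<open>auto simp: P_def\<close>)
    with 1 show ?thesis by auto
  next
    case 2
    have inj: "inj_on ?c ?C"
      by (auto simp: inj_on_def double_sets_def)
    have "\<exists>S\<subseteq>V. card S = card (?c ` N) \<and> spread (uminus ` \<A>) r S"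
    proof (rule spread_exists[OF Q3_free_uminus[OF Q3], of "?c ` ?C"])
      have "insert r (- insert r X) = - X" if "r \<notin> X" for X
        using that by auto
      then show "?c ` ?C \<subseteq> double_sets (uminus ` \<A>) r"
        by (auto simp: double_sets_def)
      show "3 \<le> card (?c ` ?C)"
        using card by (subst card_image[OF inj]) auto
      fix X assume "X \<in> ?c ` N"
      then obtain Y i where Y: "X = - insert r Y" and i: "i\<in>V - insert r Y" "\<forall>Z\<in>?C. i \<notin> Z \<longrightarrow> Z = Y"
        unfolding N_def by blast
      then show "\<exists>i\<in>X \<inter> V. \<forall>Y\<in>?c ` ?C. i \<in> Y \<longrightarrow> Y = X"
        by (intro bexI[of _ i]) auto
    qed (auto simp: N_def)
    moreover have "card (?c ` N) = card N"
      by (rule card_image, rule inj_on_subset[OF inj]) (auto simp: N_def)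
    ultimately show ?thesis using 2 by auto
  qed
  then obtain S where S: "S \<subseteq> V" "card S \<ge> s" "spread \<A> r S \<or> spread (uminus ` \<A>) r S"
    by blast
  obtain S' where S': "S' \<subseteq> S" "card S' = s"
    using S(2) by (rule obtain_subset_with_card_n)
  show ?thesis
    by (rule exI[of _ S']) (use S S' spread_mono[OF _ S'(1)] in blast)
qed

section \<open>The recursion for the upper bound\<close>

lemma few_double_sets_exists:
  assumes "Q3_free \<A>" "F11_free \<A>" "\<A> \<subseteq> Pow V" "finite V"
    and "s \<ge> 1" "2 * s \<le> card V" "2 * card V < s\<^sup>2"
  shows "\<exists>r\<in>V. card (double_sets \<A> r) \<le> 2 * s"
proof (rule ccontr)
  assume "\<not> ?thesis"
  then have *: "\<exists>S\<subseteq>V. card S = s \<and> (spread \<A> r S \<or> spread (uminus ` \<A>) r S)" if "r \<in> V" for r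
    using that assms by (intro spread_dichotomy) fastforce+
  \<comment> \<open>One of the two classes contains at least \<open>s\<close> of the at least
    \<open>2 * s\<close> rows, which contradicts \<open>spread_bound\<close> for the family or for
    its complement.\<close>
  define P where "P = {r\<in>V. \<exists>S\<subseteq>V. card S = s \<and> spread \<A> r S}"
  define N where "N = {r\<in>V. \<exists>S\<subseteq>V. card S = s \<and> spread (uminus ` \<A>) r S}"
  have "V = P \<union> N"
    using * by (auto simp: P_def N_def)
  then have "card V \<le> card P + card N"
    by (metis card_Un_le)
  then consider "s \<le> card P" | "s \<le> card N"
    using assms(6) by linarith
  then have "s\<^sup>2 \<le> 2 * card V"
  proof cases
    case 1
    show ?thesis
      by (rule spread_bound[OF assms(2) assms(4) _ 1]) (use assms(4) in \<open>auto simp: P_def\<close>)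
  next
    case 2
    show ?thesis
      by (rule spread_bound[OF F11_free_uminus[OF assms(2)] assms(4) _ 2])
        (use assms(4) in \<open>auto simp: N_def\<close>)
  qed
  with assms(7) show False by simp
qed

text \<open>Up to 16 rows the trivial bound 2^16 suffices. Beyond that, going from m to m - 1 rows
  lowers m sqrt m by at least sqrt m, so the coefficient 6 pays for a drop of at most 4 sqrt m
  columns.\<close>

lemma card_Q3_F11_free_le:
  assumes "Q3_free \<A>" "F11_free \<A>" "\<A> \<subseteq> Pow V" "finite V"
  shows "real (card \<A>) \<le> 2 ^ 16 + 6 * (real (card V) * sqrt (card V))"
  using assms
proof (induction "card V" arbitrary: V \<A>)
  case 0
  then have "card \<A> \<le> card (Pow V)"
    by (intro card_mono) auto
  with 0 show ?case by simp
next
  case (Suc n)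
  show ?case
  proof (cases "Suc n \<le> 16")
    case True
    have "card \<A> \<le> card (Pow V)"
      using Suc by (intro card_mono) auto
    also have "\<dots> = 2 ^ card V"
      using Suc.prems(4) by (rule card_Pow)
    also have "\<dots> \<le> 2 ^ 16"
      using True Suc.hyps(2) by (intro power_increasing) simp_all
    finally have "real (card \<A>) \<le> 2 ^ 16"
      by (metis of_nat_le_iff of_nat_numeral of_nat_power)
    then show ?thesis
      by (smt (verit) mult_nonneg_nonneg of_nat_0_le_iff real_sqrt_ge_zero)
  next
    case False
    define m where "m = Suc n"
    have m: "card V = m" "m \<ge> 17"
      using False Suc by (auto simp: m_def)
    \<comment> \<open>The least \<open>s\<close> with s^2 > 2m. From m \<ge> 17 follows 2s \<le> 3
      sqrt m + 2 \<le> 4 sqrt m \<le> m, as \<open>few_double_sets_exists\<close> requires.\<close>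
    define s where "s = nat \<lfloor>sqrt (2 * m)\<rfloor> + 1"
    have s: "sqrt (2 * m) < s" "s \<le> sqrt (2 * m) + 1"
      unfolding s_def by (simp_all, linarith+)
    have sq4: "sqrt m \<ge> 4"
      using m real_le_rsqrt[of 4 m] by simp
    have sq2: "sqrt (2 * m) \<le> 3 / 2 * sqrt m"
      by (rule real_le_lsqrt) (auto simp: power_mult_distrib power2_eq_square)
    have "real (2 * s) \<le> 3 * sqrt m + 2"
      using s sq2 by simp
    also have "\<dots> \<le> 4 * sqrt m"
      using sq4 by simp
    also have "\<dots> \<le> sqrt m * sqrt m"
      using sq4 by (intro mult_right_mono) auto
    finally have "2 * s \<le> m" by simp
    moreover have "(sqrt (2 * m))\<^sup>2 < (real s)\<^sup>2"
      using s by (intro power_strict_mono) auto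
    then have "real (2 * m) < real (s\<^sup>2)"
      by simp
    then have "2 * m < s\<^sup>2"
      by linarith
    ultimately obtain r where r: "r \<in> V" "card (double_sets \<A> r) \<le> 2 * s"
      using few_double_sets_exists[OF Suc.prems, of s] m by (auto simp: s_def)
    let ?B = "(\<lambda>X. X - {r}) ` \<A>"
    have "real (card ?B) \<le> 2 ^ 16 + 6 * (real (card (V - {r})) * sqrt (card (V - {r})))"
      using Suc r by (intro Suc.hyps(1) Q3_free_deletion F11_free_deletion) auto
    also have "card (V - {r}) = m - 1"
      using r m by simp
    also have "real (m - 1) * sqrt (real (m - 1)) \<le> real (m - 1) * sqrt m"
      by (intro mult_left_mono) auto
    also have "\<dots> = m * sqrt m - sqrt m"
      using m by (simp add: of_nat_diff algebra_simps)
    finally have "real (card ?B) \<le> 2 ^ 16 + 6 * (m * sqrt m - sqrt m)"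
      by simp
    moreover have "real (card (double_sets \<A> r)) \<le> 4 * sqrt m"
      using r(2) \<open>real (2 * s) \<le> 3 * sqrt m + 2\<close> sq4 by linarith
    moreover have "card \<A> = card ?B + card (double_sets \<A> r)"
      using Suc.prems by (intro card_eq_deletion_plus_double) (auto intro: finite_subset)
    ultimately show ?thesis
      using m sq4 by simp
  qed
qed

section \<open>Matrices and set families\<close>

lemma Q3_free_image:
  assumes "Q3_free \<A>" "\<A> \<subseteq> Pow V" "inj_on h V"
  shows "Q3_free ((`) h ` \<A>)"
proof (rule Q3_freeI, elim imageE)
  fix a b W X Y Y' Z Z' W0 X0 Y0 Y0' Z0 Z0'
  assume *: "W0 \<in> \<A>" "X0 \<in> \<A>" "Y0 \<in> \<A>" "Y0' \<in> \<A>" "Z0 \<in> \<A>" "Z0' \<in> \<A>"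
    and eqs: "W = h ` W0" "X = h ` X0" "Y = h ` Y0" "Y' = h ` Y0'" "Z = h ` Z0" "Z' = h ` Z0'"
    and **: "a \<notin> W" "b \<notin> W" "a \<in> X" "b \<in> X" "Y \<noteq> Y'" "Z \<noteq> Z'"
      "a \<in> Y" "b \<notin> Y" "a \<in> Y'" "b \<notin> Y'" "a \<notin> Z" "b \<in> Z" "a \<notin> Z'" "b \<in> Z'"
  obtain a0 b0 where ab: "a = h a0" "b = h b0" "a0 \<in> V" "b0 \<in> V"
    using * ** eqs assms(2) by blast
  have mem: "h v \<in> h ` U \<longleftrightarrow> v \<in> U" if "v \<in> V" "U \<in> \<A>" for v U
    using that assms(2,3) by (intro inj_on_image_mem_iff) auto
  have "Y0 \<noteq> Y0'" "Z0 \<noteq> Z0'"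
    using **(5,6) unfolding eqs by blast+
  with * **[unfolded eqs ab] show False
    by (intro Q3_freeD[OF assms(1), of W0 X0 Y0 Y0' Z0 Z0' a0 b0])
      (simp_all only: mem ab not_False_eq_True simp_thms)
qed

lemma F11_free_image:
  assumes "F11_free \<A>" "\<A> \<subseteq> Pow V" "inj_on h V"
  shows "F11_free ((`) h ` \<A>)"
proof (rule F11_freeI, elim imageE)
  fix a b c d W X Y Z W0 X0 Y0 Z0
  assume *: "W0 \<in> \<A>" "X0 \<in> \<A>" "Y0 \<in> \<A>" "Z0 \<in> \<A>"
    and eqs: "W = h ` W0" "X = h ` X0" "Y = h ` Y0" "Z = h ` Z0"
    and **: "a \<in> W" "b \<in> W" "c \<notin> W" "d \<notin> W" "a \<notin> X" "b \<notin> X" "c \<in> X" "d \<in> X"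
      "a \<in> Y" "b \<notin> Y" "c \<in> Y" "d \<notin> Y" "a \<notin> Z" "b \<in> Z" "c \<notin> Z" "d \<in> Z"
  obtain a0 b0 where ab: "a = h a0" "b = h b0" "a0 \<in> V" "b0 \<in> V"
    using * ** eqs assms(2) by blast
  obtain c0 d0 where cd: "c = h c0" "d = h d0" "c0 \<in> V" "d0 \<in> V"
    using * ** eqs assms(2) by blast
  have mem: "h v \<in> h ` U \<longleftrightarrow> v \<in> U" if "v \<in> V" "U \<in> \<A>" for v U
    using that assms(2,3) by (intro inj_on_image_mem_iff) auto
  from * **[unfolded eqs ab cd] show False
    by (intro F11_freeD[OF assms(1), of W0 X0 Y0 Z0 a0 b0 c0 d0])
      (simp_all only: mem ab cd not_False_eq_True simp_thms)
qed

section \<open>Submatrices and injective index maps\<close>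

lemma bij_betw_pick:
  "bij_betw (pick I) {..<card {i. i < n \<and> i \<in> I}} {i. i < n \<and> i \<in> I}"
proof -
  let ?I = "{i. i < n \<and> i \<in> I}"
  have pick: "pick I i = pick ?I i" if "i < card ?I" for i
    using that by (rule pick_reduce_set)
  have "inj_on (pick I) {..<card ?I}"
    by (rule linorder_inj_onI) (use pick pick_mono_le[of _ ?I] in \<open>force+\<close>)
  moreover have "pick I ` {..<card ?I} \<subseteq> ?I"
    using pick pick_in_set_le[of _ ?I] by fastforce
  moreover have "card (pick I ` {..<card ?I}) = card ?I"
    using calculation(1) by (simp add: card_image)
  ultimately show ?thesis
    unfolding bij_betw_def by (metis card_subset_eq finite_Collect_conjI finite_Collect_less_nat)
qed

text \<open>\<open>pick\<close> lists the image of \<open>f\<close> in increasing order, whereas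
  \<open>f\<close> may list it in any order; the permutation \<open>p\<close> reconciles the
  two.\<close>

lemma pick_image_permutes:
  assumes "inj_on f {..<r}" "f ` {..<r} \<subseteq> {..<n}"
  shows "card {i. i < n \<and> i \<in> f ` {..<r}} = r"
    and "\<exists>p. p permutes {..<r} \<and> (\<forall>i<r. f (p i) = pick (f ` {..<r}) i)"
proof -
  let ?I = "f ` {..<r}"
  have I: "{i. i < n \<and> i \<in> ?I} = ?I"
    using assms(2) by blast
  show card: "card {i. i < n \<and> i \<in> ?I} = r"
    unfolding I using assms(1) by (simp add: card_image)
  have pick: "bij_betw (pick ?I) {..<r} ?I"
    using bij_betw_pick[of ?I n] unfolding card unfolding I .
  have f: "bij_betw f {..<r} ?I"
    using assms(1) by (rule inj_on_imp_bij_betw)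
  define p where "p i = (if i < r then inv_into {..<r} f (pick ?I i) else i)" for i
  have "bij_betw (inv_into {..<r} f \<circ> pick ?I) {..<r} {..<r}"
    using pick bij_betw_inv_into[OF f] by (rule bij_betw_trans)
  then have "bij_betw p {..<r} {..<r}"
    by (rule bij_betw_cong[THEN iffD1, rotated]) (simp add: p_def)
  then have "p permutes {..<r}"
    by (rule bij_imp_permutes) (simp add: p_def)
  moreover have "f (p i) = pick ?I i" if "i < r" for i
    using that bij_betwE[OF pick] by (auto simp: p_def intro: f_inv_into_f)
  ultimately show "\<exists>p. p permutes {..<r} \<and> (\<forall>i<r. f (p i) = pick ?I i)"
    by blast
qed

text \<open>\<open>submatrix\<close> keeps the order of rows and columns and the permutations forget
  it, so together they amount to arbitrary injections of the indices.\<close>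

lemma configuration_in_iff_embedding:
  "F \<prec> A \<longleftrightarrow> (\<exists>f g. inj_on f {..<dim_row F} \<and> f ` {..<dim_row F} \<subseteq> {..<dim_row A} \<and>
     inj_on g {..<dim_col F} \<and> g ` {..<dim_col F} \<subseteq> {..<dim_col A} \<and>
     (\<forall>i<dim_row F. \<forall>j<dim_col F. A $$ (f i, g j) = F $$ (i, j)))" (is "_ \<longleftrightarrow> ?R")
proof
  assume "F \<prec> A"
  then obtain I J p q where p: "p permutes {..<dim_row F}" and q: "q permutes {..<dim_col F}"
    and eq: "submatrix A I J = mat (dim_row F) (dim_col F) (\<lambda>(i, j). F $$ (p i, q j))"
    unfolding configuration_in_def row_col_permutation_of_def by blast
  have dims: "card {i. i < dim_row A \<and> i \<in> I} = dim_row F" "card {j. j < dim_col A \<and> j \<in> J} = dim_col F"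
    using arg_cong[OF eq, of dim_row] arg_cong[OF eq, of dim_col] by (simp_all add: dim_submatrix)
  \<comment> \<open>Row \<open>i\<close> of \<open>F\<close> stands in row
    \<open>inv_into UNIV p i\<close> of the submatrix, which \<open>pick I\<close> translates to a
    row of \<open>A\<close>.\<close>
  define f where "f = pick I \<circ> inv_into UNIV p"
  define g where "g = pick J \<circ> inv_into UNIV q"
  have f: "bij_betw f {..<dim_row F} {i. i < dim_row A \<and> i \<in> I}"
    unfolding f_def by (rule bij_betw_trans[OF permutes_imp_bij[OF permutes_inv[OF p]]
      bij_betw_pick[of I "dim_row A", unfolded dims]])
  have g: "bij_betw g {..<dim_col F} {j. j < dim_col A \<and> j \<in> J}"
    unfolding g_def by (rule bij_betw_trans[OF permutes_imp_bij[OF permutes_inv[OF q]]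
      bij_betw_pick[of J "dim_col A", unfolded dims]])
  have "A $$ (f i, g j) = F $$ (i, j)" if "i < dim_row F" "j < dim_col F" for i j
  proof -
    have ij: "inv_into UNIV p i < dim_row F" "inv_into UNIV q j < dim_col F"
      using that permutes_in_image[OF permutes_inv[OF p]] permutes_in_image[OF permutes_inv[OF q]] by auto
    then have "submatrix A I J $$ (inv_into UNIV p i, inv_into UNIV q j) = A $$ (f i, g j)"
      by (simp add: submatrix_index dims f_def g_def)
    then show ?thesis
      using ij permutes_inverses(1)[OF p] permutes_inverses(1)[OF q] by (simp add: eq)
  qed
  moreover have "f ` {..<dim_row F} \<subseteq> {..<dim_row A}" "g ` {..<dim_col F} \<subseteq> {..<dim_col A}"
    using bij_betw_imp_surj_on[OF f] bij_betw_imp_surj_on[OF g] by blast+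
  ultimately have *: "inj_on f {..<dim_row F} \<and> f ` {..<dim_row F} \<subseteq> {..<dim_row A} \<and>
     inj_on g {..<dim_col F} \<and> g ` {..<dim_col F} \<subseteq> {..<dim_col A} \<and>
     (\<forall>i<dim_row F. \<forall>j<dim_col F. A $$ (f i, g j) = F $$ (i, j))"
    using bij_betw_imp_inj_on[OF f] bij_betw_imp_inj_on[OF g] by simp
  show ?R
    by (rule exI[of _ f], rule exI[of _ g]) (rule *)
next
  assume ?R
  then obtain f g where "inj_on f {..<dim_row F} \<and> f ` {..<dim_row F} \<subseteq> {..<dim_row A} \<and>
     inj_on g {..<dim_col F} \<and> g ` {..<dim_col F} \<subseteq> {..<dim_col A} \<and>
     (\<forall>i<dim_row F. \<forall>j<dim_col F. A $$ (f i, g j) = F $$ (i, j))"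
    by (elim exE) (rule that)
  then have f: "inj_on f {..<dim_row F}" "f ` {..<dim_row F} \<subseteq> {..<dim_row A}"
    and g: "inj_on g {..<dim_col F}" "g ` {..<dim_col F} \<subseteq> {..<dim_col A}"
    and eq: "\<And>i j. i < dim_row F \<Longrightarrow> j < dim_col F \<Longrightarrow> A $$ (f i, g j) = F $$ (i, j)"
    by simp_all
  let ?I = "f ` {..<dim_row F}" and ?J = "g ` {..<dim_col F}"
  obtain p where p: "p permutes {..<dim_row F}" "\<And>i. i < dim_row F \<Longrightarrow> f (p i) = pick ?I i"
    using pick_image_permutes(2)[OF f] by blast
  obtain q where q: "q permutes {..<dim_col F}" "\<And>j. j < dim_col F \<Longrightarrow> g (q j) = pick ?J j"
    using pick_image_permutes(2)[OF g] by blast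
  have "submatrix A ?I ?J = mat (dim_row F) (dim_col F) (\<lambda>(i, j). F $$ (p i, q j))"
  proof (rule eq_matI)
    fix i j assume "i < dim_row (mat (dim_row F) (dim_col F) (\<lambda>(i, j). F $$ (p i, q j)))"
      and "j < dim_col (mat (dim_row F) (dim_col F) (\<lambda>(i, j). F $$ (p i, q j)))"
    then have ij: "i < dim_row F" "j < dim_col F"
      by simp_all
    moreover have "p i < dim_row F" "q j < dim_col F"
      using ij permutes_in_image[OF p(1)] permutes_in_image[OF q(1)] by auto
    ultimately show "submatrix A ?I ?J $$ (i, j) =
        mat (dim_row F) (dim_col F) (\<lambda>(i, j). F $$ (p i, q j)) $$ (i, j)"
      using eq[of "p i" "q j"] p(2) q(2)
      by (simp add: submatrix_index pick_image_permutes(1)[OF f] pick_image_permutes(1)[OF g])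
  qed (simp_all add: dim_submatrix pick_image_permutes(1)[OF f] pick_image_permutes(1)[OF g])
  with p(1) q(1) show "F \<prec> A"
    unfolding configuration_in_def row_col_permutation_of_def by blast
qed

section \<open>Columns as sets of rows\<close>

definition col_support :: "int mat \<Rightarrow> nat \<Rightarrow> nat set" where
  "col_support A j = {i. i < dim_row A \<and> A $$ (i, j) = 1}"

definition col_supports :: "int mat \<Rightarrow> nat set set" where
  "col_supports A = col_support A ` {..<dim_col A}"

lemma zero_one_mat_entry:
  assumes "zero_one_mat A" "i < dim_row A" "j < dim_col A"
  shows "A $$ (i, j) = 0 \<or> A $$ (i, j) = 1"
  using assms elements_matI[of A "dim_row A" "dim_col A" i j] unfolding zero_one_mat_def by auto

lemma inj_on_col_support:
  assumes "simple_mat A"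
  shows "inj_on (col_support A) {..<dim_col A}"
proof (rule inj_onI)
  fix j k assume jk: "j \<in> {..<dim_col A}" "k \<in> {..<dim_col A}" "col_support A j = col_support A k"
  have "A $$ (i, j) = A $$ (i, k)" if "i < dim_row A" for i
  proof -
    have "A $$ (i, j) = 1 \<longleftrightarrow> A $$ (i, k) = 1"
      using eqset_imp_iff[OF jk(3), of i] that by (simp add: col_support_def)
    moreover have "A $$ (i, j) = 0 \<or> A $$ (i, j) = 1" "A $$ (i, k) = 0 \<or> A $$ (i, k) = 1"
      using assms that jk(1,2) by (simp_all add: simple_mat_def zero_one_mat_entry)
    ultimately show ?thesis
      by metis
  qed
  then have "col A j = col A k"
    by (intro eq_vecI) (use jk(1,2) in simp_all)
  moreover have "cols A ! j = col A j" "cols A ! k = col A k"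
    using jk(1,2) by simp_all
  ultimately show "j = k"
    using jk(1,2) assms by (metis simple_mat_def nth_eq_iff_index_eq cols_length lessThan_iff)
qed

lemma Q3_entries:
  "dim_row Q3 = 2" "dim_col Q3 = 6"
  "Q3 $$ (0, 0) = 0" "Q3 $$ (0, 1) = 0" "Q3 $$ (0, 2) = 0" "Q3 $$ (0, 3) = 1" "Q3 $$ (0, 4) = 1" "Q3 $$ (0, 5) = 1"
  "Q3 $$ (1, 0) = 0" "Q3 $$ (1, 1) = 1" "Q3 $$ (1, 2) = 1" "Q3 $$ (1, 3) = 0" "Q3 $$ (1, 4) = 0" "Q3 $$ (1, 5) = 1"
  by (simp_all add: Q3_def mat_of_rows_list_def)

lemma F11_entries:
  "dim_row F11 = 4" "dim_col F11 = 4"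
  "F11 $$ (0, 0) = 1" "F11 $$ (0, 1) = 0" "F11 $$ (0, 2) = 1" "F11 $$ (0, 3) = 0"
  "F11 $$ (1, 0) = 1" "F11 $$ (1, 1) = 0" "F11 $$ (1, 2) = 0" "F11 $$ (1, 3) = 1"
  "F11 $$ (2, 0) = 0" "F11 $$ (2, 1) = 1" "F11 $$ (2, 2) = 1" "F11 $$ (2, 3) = 0"
  "F11 $$ (3, 0) = 0" "F11 $$ (3, 1) = 1" "F11 $$ (3, 2) = 0" "F11 $$ (3, 3) = 1"
  by (simp_all add: F11_def mat_of_rows_list_def)

lemma all_less_2: "(\<forall>i<2. P i) \<longleftrightarrow> P (0::nat) \<and> P 1"
  and all_less_4: "(\<forall>i<4. P i) \<longleftrightarrow> P (0::nat) \<and> P 1 \<and> P 2 \<and> P 3"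
  and all_less_6: "(\<forall>i<6. P i) \<longleftrightarrow> P (0::nat) \<and> P 1 \<and> P 2 \<and> P 3 \<and> P 4 \<and> P 5"
  by (simp_all add: numeral_eq_Suc All_less_Suc conj_commute conj_left_commute)

lemma embedding_of_lists:
  assumes "distinct is" "set is \<subseteq> {..<dim_row A}" "distinct js" "set js \<subseteq> {..<dim_col A}"
    and "length is = dim_row F" "length js = dim_col F"
    and "\<forall>i<dim_row F. \<forall>j<dim_col F. A $$ (is ! i, js ! j) = F $$ (i, j)"
  shows "F \<prec> A"
proof -
  have "(!) is ` {..<dim_row F} = set is" "(!) js ` {..<dim_col F} = set js"
    using nth_image[of "length is" "is"] nth_image[of "length js" js] assms(5,6)
    by (simp_all add: atLeast0LessThan)
  moreover have "inj_on ((!) is) {..<dim_row F}" "inj_on ((!) js) {..<dim_col F}"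
    using assms(1,3,5,6) by (simp_all add: inj_on_nth)
  ultimately have *: "inj_on ((!) is) {..<dim_row F} \<and> (!) is ` {..<dim_row F} \<subseteq> {..<dim_row A} \<and>
     inj_on ((!) js) {..<dim_col F} \<and> (!) js ` {..<dim_col F} \<subseteq> {..<dim_col A} \<and>
     (\<forall>i<dim_row F. \<forall>j<dim_col F. A $$ (is ! i, js ! j) = F $$ (i, j))"
    using assms(2,4,7) by simp
  show ?thesis
    unfolding configuration_in_iff_embedding
    by (rule exI[of _ "(!) is"], rule exI[of _ "(!) js"]) (rule *)
qed

text \<open>Columns 0 to 5 of \<open>Q3\<close> correspond to \<open>W\<close>, \<open>Z\<close>,
  \<open>Z'\<close>, \<open>Y\<close>, \<open>Y'\<close>, \<open>X\<close>. As \<open>A\<close> is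
  simple, distinct column indices give distinct sets, which the repeated columns of
  \<open>Q3\<close> demand.\<close>

lemma Q3_in_iff:
  assumes "simple_mat A"
  shows "Q3 \<prec> A \<longleftrightarrow> \<not> Q3_free (col_supports A)"
proof
  assume "Q3 \<prec> A"
  then obtain f g where f: "f ` {..<2} \<subseteq> {..<dim_row A}"
    and g: "inj_on g {..<6}" "g ` {..<6} \<subseteq> {..<dim_col A}"
    and eq: "\<forall>i<2. \<forall>j<6. A $$ (f i, g j) = Q3 $$ (i, j)"
    unfolding configuration_in_iff_embedding Q3_entries by (elim exE conjE) (rule that)
  have cols: "col_support A (g j) \<in> col_supports A" if "j < 6" for j
    using that g(2) by (auto simp: col_supports_def)
  have neq: "col_support A (g j) \<noteq> col_support A (g k)" if "j < 6" "k < 6" "j \<noteq> k" for j k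
    using inj_onD[OF inj_on_col_support[OF assms], of "g j" "g k"] inj_onD[OF g(1), of j k] g(2) that by auto
  have mem: "f i \<in> col_support A (g j) \<longleftrightarrow> Q3 $$ (i, j) = 1" if "i < 2" "j < 6" for i j
    using that f eq by (auto simp: col_support_def)
  show "\<not> Q3_free (col_supports A)"
    by (rule notI, rule Q3_freeD[of _ "col_support A (g 0)" "col_support A (g 5)"
        "col_support A (g 3)" "col_support A (g 4)" "col_support A (g 1)" "col_support A (g 2)" "f 0" "f 1"])
      (simp_all only: cols neq mem Q3_entries, simp_all add: cols neq mem Q3_entries)
next
  assume notfree: "\<not> Q3_free (col_supports A)"
  have zero: "A $$ (i, j) = 0" if "i \<notin> col_support A j" "i < dim_row A" "j < dim_col A" for i j
    using that zero_one_mat_entry[of A i j] assms by (auto simp: simple_mat_def col_support_def)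
  have one: "A $$ (i, j) = 1" if "i \<in> col_support A j" for i j
    using that by (simp add: col_support_def)
  show "Q3 \<prec> A"
  proof (rule ccontr)
    assume nQ3: "\<not> Q3 \<prec> A"
    have "Q3_free (col_supports A)"
      unfolding col_supports_def
    proof (rule Q3_freeI, elim imageE)
      fix a b W X Y Y' Z Z' w x y y' z z'
      assume ab: "a \<notin> W" "b \<notin> W" "a \<in> X" "b \<in> X" "Y \<noteq> Y'" "Z \<noteq> Z'"
          "a \<in> Y" "b \<notin> Y" "a \<in> Y'" "b \<notin> Y'" "a \<notin> Z" "b \<in> Z" "a \<notin> Z'" "b \<in> Z'"
        and cols: "w \<in> {..<dim_col A}" "x \<in> {..<dim_col A}" "y \<in> {..<dim_col A}"
          "y' \<in> {..<dim_col A}" "z \<in> {..<dim_col A}" "z' \<in> {..<dim_col A}"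
        and eqs: "W = col_support A w" "X = col_support A x" "Y = col_support A y"
          "Y' = col_support A y'" "Z = col_support A z" "Z' = col_support A z'"
      note ab = ab[unfolded eqs] and cols = cols[unfolded lessThan_iff]
      have rows: "a < dim_row A" "b < dim_row A"
        using ab(3,4) by (simp_all add: col_support_def)
      have "a \<noteq> b" "y \<noteq> y'" "z \<noteq> z'"
        using ab by blast+
      moreover have "w \<noteq> z" "w \<noteq> z'" "w \<noteq> y" "w \<noteq> y'" "w \<noteq> x" "z \<noteq> y" "z \<noteq> y'" "z \<noteq> x"
          "z' \<noteq> y" "z' \<noteq> y'" "z' \<noteq> x" "y \<noteq> x" "y' \<noteq> x"
        using ab by blast+
      ultimately have "distinct [a, b]" "distinct [w, z, z', y, y', x]"
        by simp_all
      moreover have "\<forall>i<2. \<forall>j<6. A $$ ([a, b] ! i, [w, z, z', y, y', x] ! j) = Q3 $$ (i, j)"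
        unfolding all_less_2 all_less_6 using rows cols ab by (simp add: Q3_entries[unfolded One_nat_def] zero one)
      ultimately have "Q3 \<prec> A"
        using rows cols by (intro embedding_of_lists[of "[a, b]" _ "[w, z, z', y, y', x]"])
          (simp_all add: Q3_entries)
      with nQ3 show False by blast
    qed
    with notfree show False by blast
  qed
qed

lemma F11_in_iff:
  assumes "simple_mat A"
  shows "F11 \<prec> A \<longleftrightarrow> \<not> F11_free (col_supports A)"
proof
  assume "F11 \<prec> A"
  then obtain f g where f: "f ` {..<4} \<subseteq> {..<dim_row A}" and g: "g ` {..<4} \<subseteq> {..<dim_col A}"
    and eq: "\<forall>i<4. \<forall>j<4. A $$ (f i, g j) = F11 $$ (i, j)"
    unfolding configuration_in_iff_embedding F11_entries by (elim exE conjE) (rule that)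
  have cols: "col_support A (g j) \<in> col_supports A" if "j < 4" for j
    using that g by (auto simp: col_supports_def)
  have mem: "f i \<in> col_support A (g j) \<longleftrightarrow> F11 $$ (i, j) = 1" if "i < 4" "j < 4" for i j
    using that f eq by (auto simp: col_support_def)
  show "\<not> F11_free (col_supports A)"
    by (rule notI, rule F11_freeD[of _ "col_support A (g 0)" "col_support A (g 1)"
        "col_support A (g 2)" "col_support A (g 3)" "f 0" "f 1" "f 2" "f 3"])
      (simp_all only: cols mem F11_entries, simp_all add: cols mem F11_entries)
next
  assume notfree: "\<not> F11_free (col_supports A)"
  have zero: "A $$ (i, j) = 0" if "i \<notin> col_support A j" "i < dim_row A" "j < dim_col A" for i j
    using that zero_one_mat_entry[of A i j] assms by (auto simp: simple_mat_def col_support_def)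
  have one: "A $$ (i, j) = 1" if "i \<in> col_support A j" for i j
    using that by (simp add: col_support_def)
  show "F11 \<prec> A"
  proof (rule ccontr)
    assume nF11: "\<not> F11 \<prec> A"
    have "F11_free (col_supports A)"
      unfolding col_supports_def
    proof (rule F11_freeI, elim imageE)
      fix a b c d W X Y Z w x y z
      assume ab: "a \<in> W" "b \<in> W" "c \<notin> W" "d \<notin> W" "a \<notin> X" "b \<notin> X" "c \<in> X" "d \<in> X"
          "a \<in> Y" "b \<notin> Y" "c \<in> Y" "d \<notin> Y" "a \<notin> Z" "b \<in> Z" "c \<notin> Z" "d \<in> Z"
        and cols: "w \<in> {..<dim_col A}" "x \<in> {..<dim_col A}" "y \<in> {..<dim_col A}" "z \<in> {..<dim_col A}"
        and eqs: "W = col_support A w" "X = col_support A x" "Y = col_support A y" "Z = col_support A z"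
      note ab = ab[unfolded eqs] and cols = cols[unfolded lessThan_iff]
      have rows: "a < dim_row A" "b < dim_row A" "c < dim_row A" "d < dim_row A"
        using ab(1,2,7,8) by (simp_all add: col_support_def)
      have "a \<noteq> b" "a \<noteq> c" "a \<noteq> d" "b \<noteq> c" "b \<noteq> d" "c \<noteq> d"
        using ab by blast+
      moreover have "w \<noteq> x" "w \<noteq> y" "w \<noteq> z" "x \<noteq> y" "x \<noteq> z" "y \<noteq> z"
        using ab by blast+
      ultimately have "distinct [a, b, c, d]" "distinct [w, x, y, z]"
        by simp_all
      moreover have "\<forall>i<4. \<forall>j<4. A $$ ([a, b, c, d] ! i, [w, x, y, z] ! j) = F11 $$ (i, j)"
        unfolding all_less_4 using rows cols ab by (simp add: F11_entries[unfolded One_nat_def] zero one)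
      ultimately have "F11 \<prec> A"
        using rows cols by (intro embedding_of_lists[of "[a, b, c, d]" _ "[w, x, y, z]"])
          (simp_all add: F11_entries)
      with nF11 show False by blast
    qed
    with notfree show False by blast
  qed
qed

section \<open>Set families and the maximum\<close>

lemma forb_attained:
  obtains \<A> where "\<A> \<subseteq> Pow {..<m}" "card \<A> = forb m {Q3, F11}" "Q3_free \<A>" "F11_free \<A>"
proof -
  have "avoiding_mats m {Q3, F11} \<noteq> {}"
    by (rule avoiding_mats_nonempty) (simp add: Q3_entries F11_entries)
  then have "forb m {Q3, F11} \<in> dim_col ` avoiding_mats m {Q3, F11}"
    unfolding forb_def by (intro Max_in finite_dim_col_avoiding_mats) simp
  then obtain A where A: "forb m {Q3, F11} = dim_col A" "dim_row A = m" "simple_mat A"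
    "\<not> Q3 \<prec> A" "\<not> F11 \<prec> A"
    by (auto simp: avoiding_mats_def)
  show ?thesis
  proof (rule that)
    show "col_supports A \<subseteq> Pow {..<m}"
      using A(2) by (auto simp: col_supports_def col_support_def)
    show "card (col_supports A) = forb m {Q3, F11}"
      using A(1) inj_on_col_support[OF A(3)] by (simp add: col_supports_def card_image)
  qed (use A Q3_in_iff F11_in_iff in blast)+
qed

text \<open>The source of lower bounds: an injection moves the points of any family into the first
  \<open>m\<close> rows, and rows outside its image become zero rows.\<close>

lemma card_le_forb:
  assumes "Q3_free \<A>" "F11_free \<A>" "\<A> \<subseteq> Pow V" "finite V" "card V \<le> m"
  shows "card \<A> \<le> forb m {Q3, F11}"
proof -
  obtain h where h: "inj_on h V" "h ` V \<subseteq> {..<m}"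
    using assms(4,5) card_le_inj[of V "{..<m}"] by auto
  let ?B = "(`) h ` \<A>"
  have "finite \<A>"
    using assms(3,4) by (meson finite_Pow_iff finite_subset)
  then obtain g where g: "bij_betw g {..<card ?B} ?B"
    using ex_bij_betw_nat_finite[of ?B] by (auto simp: atLeast0LessThan)
  define A :: "int mat" where "A = mat m (card ?B) (\<lambda>(i, j). if i \<in> g j then 1 else 0)"
  have dims: "dim_row A = m" "dim_col A = card ?B"
    by (simp_all add: A_def)
  have supp: "col_support A j = g j" if "j < card ?B" for j
  proof -
    have "g j \<in> ?B"
      using that bij_betwE[OF g] by blast
    then have "g j \<subseteq> {..<m}"
      using h(2) assms(3) by blast
    with that show ?thesis
      by (auto simp: col_support_def A_def split: if_splits)
  qed
  then have supps: "col_supports A = ?B"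
    using g by (auto simp: col_supports_def dims bij_betw_def)
  have "distinct (cols A)"
    unfolding distinct_conv_nth
  proof (intro allI impI)
    fix j k assume jk: "j < length (cols A)" "k < length (cols A)" "j \<noteq> k"
    then have "g j \<noteq> g k"
      using g by (auto simp: dims bij_betw_def inj_on_def)
    then have "col_support A j \<noteq> col_support A k"
      using jk supp by (simp add: dims)
    moreover have "col_support A j = {i. i < m \<and> col A j $ i = 1}" if "j < dim_col A" for j
      using that by (auto simp: col_support_def dims)
    ultimately show "cols A ! j \<noteq> cols A ! k"
      using jk by auto
  qed
  then have "simple_mat A"
    by (auto simp: simple_mat_def zero_one_mat_def elements_mat_def A_def)
  moreover have "Q3_free ?B" "F11_free ?B"
    by (rule Q3_free_image[OF assms(1,3) h(1)], rule F11_free_image[OF assms(2,3) h(1)])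
  ultimately have "A \<in> avoiding_mats m {Q3, F11}"
    by (simp add: avoiding_mats_def dims Q3_in_iff F11_in_iff supps)
  then have "dim_col A \<le> forb m {Q3, F11}"
    unfolding forb_def by (intro Max_ge finite_dim_col_avoiding_mats) blast
  moreover have "card ?B = card \<A>"
    using assms(3) inj_on_image_Pow[OF h(1)] by (meson card_image inj_on_subset)
  ultimately show ?thesis
    by (simp add: dims)
qed

section \<open>Incident pairs of an affine plane\<close>

text \<open>The pair of the point \<open>(x, y)\<close> and the line \<open>(a, b)\<close> with \<open>b = a x + y\<close> gives the column with
  a single 1 in the rows of the points and a single 0 in the rows of the lines.\<close>

definition flag :: "'a::field set \<Rightarrow> 'a \<times> 'a \<times> 'a \<Rightarrow> ('a \<times> 'a + 'a \<times> 'a) set" where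
  "flag K = (\<lambda>(x, y, a). insert (Inl (x, y)) (Inr ` (K \<times> K - {(a, a * x + y)})))"

definition flags :: "'a::field set \<Rightarrow> ('a \<times> 'a + 'a \<times> 'a) set set" where
  "flags K = flag K ` (K \<times> K \<times> K)"

lemma Inl_mem_flag: "Inl p \<in> flag K (x, y, a) \<longleftrightarrow> p = (x, y)"
  and Inr_mem_flag: "Inr l \<in> flag K (x, y, a) \<longleftrightarrow> l \<in> K \<times> K \<and> l \<noteq> (a, a * x + y)"
  by (auto simp: flag_def)

text \<open>The point gives \<open>x\<close> and \<open>y\<close>, the line gives \<open>a\<close>.
  A row \<open>Inr l\<close> with \<open>l\<close> outside \<open>K \<times> K\<close> is 0 in every
  flag, so a 0 expresses incidence only for \<open>l\<close> in \<open>K \<times> K\<close>.\<close>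

lemma flags_sameI:
  assumes "X \<in> flags K" "Y \<in> flags K" "Inl p \<in> X" "Inl p \<in> Y"
    "Inr l \<notin> X" "Inr l \<notin> Y" "l \<in> K \<times> K"
  shows "X = Y"
  using assms unfolding flags_def by (auto simp: Inl_mem_flag Inr_mem_flag)

lemma Inl_flags_disjoint:
  assumes "X \<in> flags K" "Inl p \<in> X" "Inl p' \<in> X" shows "p = p'"
  using assms unfolding flags_def by (auto simp: Inl_mem_flag)

lemma Inr_flags_cover:
  assumes "X \<in> flags K" "l \<in> K \<times> K" "l' \<in> K \<times> K" "Inr l \<notin> X" "Inr l' \<notin> X" shows "l = l'"
  using assms unfolding flags_def by (auto simp: Inr_mem_flag)

text \<open>Every row of a forbidden configuration has a 1 somewhere, so this supplies the
  membership conditions of the preceding lemmas.\<close>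

lemma Inr_mem_flagsD:
  assumes "X \<in> flags K" "Inr l \<in> X" shows "l \<in> K \<times> K"
  using assms unfolding flags_def by (auto simp: Inr_mem_flag)

lemma flag_incident:
  assumes "X \<in> flags K" "Inl (x, y) \<in> X" "Inr (a, b) \<notin> X" "(a, b) \<in> K \<times> K"
  shows "b = a * x + y"
  using assms unfolding flags_def by (auto simp: Inl_mem_flag Inr_mem_flag)

text \<open>The equations give (a - a')(x - x') = 0; here a = a' makes the lines equal and x = x'
  makes the points equal.\<close>

lemma two_points_two_lines:
  fixes a :: "'a::field"
  assumes "b = a * x + y" "b' = a' * x + y" "b = a * x' + y'" "b' = a' * x' + y'"
  shows "(x, y) = (x', y') \<or> (a, b) = (a', b')"
proof -
  have "(a - a') * (x - x') = (a * x + y) - (a' * x + y) - ((a * x' + y') - (a' * x' + y'))"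
    by (simp add: algebra_simps)
  also have "\<dots> = 0"
    using assms by simp
  finally show ?thesis
    using assms by auto
qed

text \<open>Two points never share a 1, two lines never share a 0, and a point and a line have at
  most one column with a 1 at the point and a 0 at the line.\<close>

lemma Q3_free_flags: "Q3_free (flags K)"
proof (rule Q3_freeI)
  fix a b W X Y Y' Z Z'
  assume mem: "W \<in> flags K" "X \<in> flags K" "Y \<in> flags K" "Y' \<in> flags K" "Z \<in> flags K" "Z' \<in> flags K"
    and **: "a \<notin> W" "b \<notin> W" "a \<in> X" "b \<in> X" "Y \<noteq> Y'" "Z \<noteq> Z'"
      "a \<in> Y" "b \<notin> Y" "a \<in> Y'" "b \<notin> Y'" "a \<notin> Z" "b \<in> Z" "a \<notin> Z'" "b \<in> Z'"
  show False
  proof (cases a; cases b)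
    fix p p' assume "a = Inl p" "b = Inl p'"
    with mem ** show False
      using Inl_flags_disjoint[of X K p p'] by simp
  next
    fix p l assume "a = Inl p" "b = Inr l"
    with mem ** show False
      using flags_sameI[of Y K Y' p l] Inr_mem_flagsD[of X K l] by simp
  next
    fix l p assume "a = Inr l" "b = Inl p"
    with mem ** show False
      using flags_sameI[of Z K Z' p l] Inr_mem_flagsD[of X K l] by simp
  next
    fix l l' assume "a = Inr l" "b = Inr l'"
    with mem ** show False
      using Inr_flags_cover[of W K l l'] Inr_mem_flagsD[of X K l] Inr_mem_flagsD[of X K l'] by simp
  qed
qed

text \<open>Rows \<open>a\<close>, \<open>b\<close> share a 1 and share a 0, so one is a point and
  the other a line; likewise \<open>a\<close>, \<open>c\<close> and \<open>b\<close>,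
  \<open>d\<close>. Hence \<open>a\<close>, \<open>d\<close> are of one kind and \<open>b\<close>,
  \<open>c\<close> of the other, and the columns make two distinct points incident with two distinct
  lines.\<close>

lemma F11_free_flags: "F11_free (flags K)"
proof (rule F11_freeI)
  fix a b c d W X Y Z
  assume mem: "W \<in> flags K" "X \<in> flags K" "Y \<in> flags K" "Z \<in> flags K"
    and **: "a \<in> W" "b \<in> W" "c \<notin> W" "d \<notin> W" "a \<notin> X" "b \<notin> X" "c \<in> X" "d \<in> X"
      "a \<in> Y" "b \<notin> Y" "c \<in> Y" "d \<notin> Y" "a \<notin> Z" "b \<in> Z" "c \<notin> Z" "d \<in> Z"
  have both_Inl: "p = p'" if "U \<in> flags K" "Inl p \<in> U" "Inl p' \<in> U" for U p p'
    using that by (rule Inl_flags_disjoint)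
  have both_Inr: "l = l'" if "U \<in> flags K" "Inr l \<notin> U" "Inr l' \<notin> U" "T \<in> flags K" "Inr l \<in> T"
    "T' \<in> flags K" "Inr l' \<in> T'" for U T T' l l'
    using Inr_flags_cover[of U K l l'] Inr_mem_flagsD[of T K l] Inr_mem_flagsD[of T' K l'] that by simp
  have cycle: False
    if "W \<in> flags K" "X \<in> flags K" "Y \<in> flags K" "Z \<in> flags K" "a = Inl p" "d = Inl p'" "b = Inr l" "c = Inr l'"
      and **: "a \<in> W" "b \<in> W" "c \<notin> W" "d \<notin> W" "a \<notin> X" "b \<notin> X" "c \<in> X" "d \<in> X"
      "a \<in> Y" "b \<notin> Y" "c \<in> Y" "d \<notin> Y" "a \<notin> Z" "b \<in> Z" "c \<notin> Z" "d \<in> Z"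
    for a b c d W X Y Z p p' l l'
  proof -
    obtain x y x' y' where p: "p = (x, y)" "p' = (x', y')"
      by (metis surj_pair)
    obtain s t s' t' where l: "l = (s, t)" "l' = (s', t')"
      by (metis surj_pair)
    have "l \<in> K \<times> K" "l' \<in> K \<times> K"
      using Inr_mem_flagsD[of W K l] Inr_mem_flagsD[of X K l'] that by auto
    then have "t' = s' * x + y" "t = s * x' + y'" "t = s * x + y" "t' = s' * x' + y'"
      using flag_incident[of W K x y s' t'] flag_incident[of X K x' y' s t]
        flag_incident[of Y K x y s t] flag_incident[of Z K x' y' s' t'] that p l
      by auto
    then have "p = p' \<or> l = l'"
      using two_points_two_lines unfolding p l by blast
    with that show False
      by auto
  qed
  show False
  proof (cases a)
    case a: (Inl p)
    obtain l where b: "b = Inr l"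
      using both_Inl[of W p] a ** mem by (metis sum.exhaust)
    obtain l' where c: "c = Inr l'"
      using both_Inl[of Y p] a ** mem by (metis sum.exhaust)
    obtain p' where d: "d = Inl p'"
      using both_Inr[of Y l _ W Z] b ** mem by (metis sum.exhaust)
    show False
      by (rule cycle[OF mem a d b c]) (fact **)+
  next
    case a: (Inr l)
    obtain p where b: "b = Inl p"
      using both_Inr[of X l _ W W] a ** mem by (metis sum.exhaust)
    obtain p' where c: "c = Inl p'"
      using both_Inr[of Z l _ W X] a ** mem by (metis sum.exhaust)
    obtain l' where d: "d = Inr l'"
      using both_Inl[of Z p] b ** mem by (metis sum.exhaust)
    \<comment> \<open>Swapping \<open>a\<close> with \<open>b\<close>, \<open>c\<close> with
      \<open>d\<close> and \<open>Y\<close> with \<open>Z\<close> preserves the pattern and reduces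
      this case to the first.\<close>
    show False
      by (rule cycle[OF mem(1,2,4,3) b c a d]) (fact **)+
  qed
qed

text \<open>The point and the missing line of a flag recover \<open>x\<close>, \<open>y\<close> and
  \<open>a\<close>; closure of \<open>K\<close> ensures that the line \<open>(a, a * x + y)\<close>
  is among the rows.\<close>

lemma card_flags:
  assumes "\<And>x y. x \<in> K \<Longrightarrow> y \<in> K \<Longrightarrow> x + y \<in> K \<and> x * y \<in> K"
  shows "card (flags K) = card K ^ 3"
proof -
  have "inj_on (flag K) (K \<times> K \<times> K)"
  proof (rule inj_onI)
    fix u v assume uv: "u \<in> K \<times> K \<times> K" "flag K u = flag K v"
    obtain x y a x' y' a' where u: "u = (x, y, a)" and v: "v = (x', y', a')"
      by (metis surj_pair)
    from uv have K: "x \<in> K" "y \<in> K" "a \<in> K" and eq: "flag K (x, y, a) = flag K (x', y', a')"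
      by (simp_all add: u v)
    have "Inl (x, y) \<in> flag K (x', y', a')" "Inr (a, a * x + y) \<notin> flag K (x', y', a')"
      unfolding eq[symmetric] by (simp_all add: Inl_mem_flag Inr_mem_flag)
    with K assms show "u = v"
      by (simp add: u v Inl_mem_flag Inr_mem_flag)
  qed
  then show ?thesis
    by (simp add: flags_def card_image card_cartesian_product power3_eq_cube)
qed

section \<open>Finite fields of characteristic two\<close>

text \<open>No root is shared with the derivative, so all roots are simple, and over an
  algebraically closed field the roots counted with multiplicity number the degree.\<close>

lemma card_roots_eq_degree:
  fixes p :: "'a :: alg_closed_field poly"
  assumes "\<And>x. poly p x = 0 \<Longrightarrow> poly (pderiv p) x \<noteq> 0"
  shows "card {x. poly p x = 0} = Polynomial.degree p"
proof -
  have "p \<noteq> 0"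
    using assms[of 0] by auto
  have "order x p \<le> 1" for x
  proof (rule ccontr)
    assume "\<not> order x p \<le> 1"
    then have "[:-x, 1:] ^ 2 dvd p"
      by (intro dvd_trans[OF le_imp_power_dvd order_1]) simp
    then obtain q where "p = [:-x, 1:] * ([:-x, 1:] * q)"
      by (metis dvdE mult.assoc power2_eq_square)
    then have "poly p x = 0" "poly (pderiv p) x = 0"
      by (simp_all add: pderiv_mult del: mult_pCons_left)
    with assms show False
      by blast
  qed
  moreover have "order x p = 0 \<longleftrightarrow> poly p x \<noteq> 0" for x
    using \<open>p \<noteq> 0\<close> by (auto simp: order_root)
  ultimately have "order x p = (if poly p x = 0 then 1 else 0)" for x
    by (metis One_nat_def le_Suc_eq le_zero_eq)
  with \<open>p \<noteq> 0\<close> have eq: "proots p = mset_set {x. poly p x = 0}"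
    by (intro multiset_eqI) (simp add: poly_roots_finite count_mset_set')
  obtain A where "size A = Polynomial.degree p"
    and "p = smult (lead_coeff p) (\<Prod>x\<in>#A. [:-x, 1:])"
    using alg_closed_imp_factorization[OF \<open>p \<noteq> 0\<close>] by blast
  moreover have "proots (\<Prod>x\<in>#A. [:-x, 1:]) = A"
  proof (induction A)
    case (add x A)
    have "(\<Prod>x\<in>#A. [:-x, 1:]) \<noteq> 0"
      by (auto simp: prod_mset_zero_iff)
    with add show ?case
      by (simp add: proots_mult del: mult_pCons_left)
  qed simp
  ultimately have "size (proots p) = Polynomial.degree p"
    using \<open>p \<noteq> 0\<close> by (metis proots_smult leading_coeff_0_iff)
  then show ?thesis
    by (simp add: eq)
qed

text \<open>\<open>K\<close> consists of the roots of X^q - X, q = 2^(k+1), in an algebraic closure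
  of the field with two elements. The successor makes q even and the polynomial nonzero. Closure
  under sums is additivity of the Frobenius map.\<close>

lemma finite_subfield_exists:
  "\<exists>K :: bit alg_closure set. card K = 2 ^ Suc k \<and> (\<forall>x\<in>K. \<forall>y\<in>K. x + y \<in> K \<and> x * y \<in> K)"
proof -
  let ?q = "2 ^ Suc k :: nat"
  let ?p = "monom 1 ?q - monom 1 1 :: bit alg_closure poly"
  define K where "K = {x :: bit alg_closure. x ^ ?q = x}"
  have two: "(2 :: bit alg_closure) = 0"
    by (metis to_ac_numeral bit_numeral_even to_ac_0)
  have char: "CHAR(bit alg_closure) = 2"
    by (rule CHAR_eq_posI) (use two in \<open>auto simp: less_2_cases_iff\<close>)
  \<comment> \<open>The derivative is q X^(q-1) - 1, and q vanishes in characteristic two.\<close>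
  have "poly (pderiv ?p) x = -1" for x
    by (simp add: pderiv_monom pderiv_diff poly_monom two)
  then have "card {x. poly ?p x = 0} = Polynomial.degree ?p"
    by (intro card_roots_eq_degree) simp
  moreover have "Polynomial.degree ?p = ?q"
  proof -
    have "Polynomial.degree (monom (1 :: bit alg_closure) 1) < ?q"
      using one_less_power[of "2::nat" "Suc k"] by (simp add: degree_monom_eq del: power_Suc)
    then show ?thesis
      by (subst diff_conv_add_uminus, subst degree_add_eq_left) (auto simp: degree_monom_eq)
  qed
  ultimately have "card K = ?q"
    by (simp add: K_def poly_monom)
  moreover have "x + y \<in> K" "x * y \<in> K" if "x \<in> K" "y \<in> K" for x y
    using that freshmans_dream'[where 'a = "bit alg_closure", of _ "Suc k" x y]
    unfolding K_def char mem_Collect_eq by (simp_all add: power_mult_distrib del: power_Suc)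
  ultimately show ?thesis
    by blast
qed

section \<open>The asymptotic bound\<close>

text \<open>With 2^n field elements there are 4^n points and 4^n lines as rows, and (2^n)^3 flags as
  columns.\<close>

lemma card_plane_flags_le_forb:
  assumes "2 * 4 ^ n \<le> m" "n \<ge> 1"
  shows "8 ^ n \<le> forb m {Q3, F11}"
proof -
  obtain K :: "bit alg_closure set" where K: "card K = 2 ^ n"
    "\<And>x y. x \<in> K \<Longrightarrow> y \<in> K \<Longrightarrow> x + y \<in> K \<and> x * y \<in> K"
    using finite_subfield_exists[of "n - 1"] assms(2) by auto
  have "finite K"
    using K(1) by (intro card_ge_0_finite) simp
  have "card (flags K) \<le> forb m {Q3, F11}"
  proof (rule card_le_forb[OF Q3_free_flags F11_free_flags])
    show "flags K \<subseteq> Pow (K \<times> K <+> K \<times> K)"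
      by (auto simp: flags_def flag_def)
    show "finite (K \<times> K <+> K \<times> K)"
      using \<open>finite K\<close> by simp
    have "(2 ^ n * 2 ^ n :: nat) = 4 ^ n"
      by (simp flip: power_mult_distrib)
    then show "card (K \<times> K <+> K \<times> K) \<le> m"
      using \<open>finite K\<close> assms(1) by (simp add: card_Plus card_cartesian_product K(1))
  qed
  moreover have "(2 ^ n :: nat) ^ 3 = 8 ^ n"
    by (simp add: power3_eq_cube flip: power_mult_distrib)
  ultimately show ?thesis
    using card_flags[of K] K by simp
qed

lemma powr_three_halves: "real m powr (3 / 2) = real m * sqrt (real m)"
proof (cases "m = 0")
  case False
  have "real m powr (1 + 1 / 2) = real m * sqrt (real m)"
    using False by (simp only: powr_add powr_one powr_half_sqrt of_nat_0_le_iff)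
  then show ?thesis by simp
qed simp

theorem corollary4p13:
  shows "(\<lambda>m. real (forb m {Q3, F11})) \<in> \<Theta>(\<lambda>m. real m powr (3 / 2))"
proof (rule bigthetaI)
  show "(\<lambda>m. real (forb m {Q3, F11})) \<in> O(\<lambda>m. real m powr (3 / 2))"
  \<comment> \<open>For m \<ge> 1 also m sqrt m \<ge> 1, so the additive 2^16 can be absorbed into
    the coefficient.\<close>
  proof (rule bigoI[where c = "2 ^ 16 + 6"], rule eventually_sequentiallyI[of 1])
    fix m :: nat assume "1 \<le> m"
    obtain \<A> where \<A>: "\<A> \<subseteq> Pow {..<m}" "card \<A> = forb m {Q3, F11}" "Q3_free \<A>" "F11_free \<A>"
      by (rule forb_attained)
    have "real (forb m {Q3, F11}) \<le> 2 ^ 16 + 6 * (real m * sqrt m)"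
      using card_Q3_F11_free_le[OF \<A>(3,4,1)] \<A>(2) by simp
    moreover have "1 * 1 \<le> real m * sqrt m"
      using \<open>1 \<le> m\<close> by (intro mult_mono) auto
    ultimately show "norm (real (forb m {Q3, F11})) \<le> (2 ^ 16 + 6) * norm (real m powr (3 / 2))"
      by (simp add: powr_three_halves)
  qed
  show "(\<lambda>m. real (forb m {Q3, F11})) \<in> \<Omega>(\<lambda>m. real m powr (3 / 2))"
  \<comment> \<open>Let n be the largest exponent with 2 4^n \<le> m. Then m < 8 4^n and sqrt m
    \<le> 3 2^n, as 8 < 9, so m sqrt m \<le> 24 8^n. The threshold 8 ensures n \<ge> 1.\<close>
  proof (rule landau_omega.bigI[where c = "1 / 24"], simp, rule eventually_sequentiallyI[of 8])
    fix m :: nat assume "8 \<le> m"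
    then have "1 \<le> m div 2"
      by linarith
    then obtain n where n: "4 ^ n \<le> m div 2" "m div 2 < 4 ^ (n + 1)"
      using ex_power_ivl1[of 4 "m div 2"] by auto
    have "n \<noteq> 0"
      using n(2) \<open>8 \<le> m\<close> by (intro notI) simp
    then have "8 ^ n \<le> forb m {Q3, F11}"
      using n(1) by (intro card_plane_flags_le_forb) linarith+
    then have "(8 :: real) ^ n \<le> real (forb m {Q3, F11})"
      by simp
    moreover have "real m * sqrt m \<le> 24 * 8 ^ n"
    proof -
      have "m < 8 * 4 ^ n"
        using n(2) by simp
      then have m: "real m \<le> 8 * 4 ^ n"
        by (simp add: order_less_imp_le flip: of_nat_less_iff[where 'a = real])
      have "(2 ^ n * 2 ^ n :: real) = 4 ^ n"
        by (simp flip: power_mult_distrib)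
      then have "(3 * 2 ^ n :: real)\<^sup>2 = 9 * 4 ^ n"
        by (simp add: power2_eq_square)
      moreover have "0 \<le> (4 :: real) ^ n"
        by simp
      ultimately have "real m \<le> (3 * 2 ^ n)\<^sup>2"
        using m by linarith
      then have "sqrt m \<le> 3 * 2 ^ n"
        by (intro real_le_lsqrt) simp_all
      with m have "real m * sqrt m \<le> (8 * 4 ^ n) * (3 * 2 ^ n)"
        by (intro mult_mono) auto
      also have "\<dots> = 24 * (4 * 2) ^ n"
        by (simp only: power_mult_distrib)
      finally show ?thesis
        by simp
    qed
    ultimately have "real m * sqrt m \<le> 24 * real (forb m {Q3, F11})"
      by linarith
    then show "norm (real (forb m {Q3, F11})) \<ge> 1 / 24 * norm (real m powr (3 / 2))"
      by (simp add: powr_three_halves)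
  qed
qed

end
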